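(* Let $\mathcal{I}$ be an atomless ideal on a set $X$. Then $h\pi(P(X)/\mathcal{I})\geq \operatorname{add}(\mathcal{I})$; that is, for every $A\in\mathcal{I}^+$, every dense subset of the Boolean algebra $P(X)/(\mathcal{I}\upharpoonright A)$ has cardinality at least $\operatorname{add}(\mathcal{I})$.
   Context: An ideal on a set $X$ is a family $\mathcal{I}\subseteq P(X)$ such that (i) if $A_0,A_1\in\mathcal{I}$ and $A\subseteq A_0\cup A_1$ then $A\in\mathcal{I}$; (ii) $X\notin\mathcal{I}$ and $\{x\}\in\mathcal{I}$ for every $x\in X$. Write $\mathcal{I}^+=P(X)\setminus\mathcal{I}$ (the $\mathcal{I}$-positive sets). $\mathcal{I}$ is $\kappa$-complete if the union of any fewer than $\kappa$ members of $\mathcal{I}$ is in $\mathcal{I}$; $\operatorname{add}(\mathcal{I})$ is the least $\kappa$ such that $\mathcal{I}$ is not $\kappa$-complete. $P(X)/\mathcal{I}$ is the quotient Boolean algebra with $[A]\leq[B]$ iff $A\setminus B\in\mathcal{I}$. $\mathcal{I}$ is atomless if $P(X)/\mathcal{I}$ is an atomless Boolean algebra. For $A\in\mathcal{I}^+$, the restriction is $\mathcal{I}\upharpoonright A=\{B\subseteq X: B\cap A\in\mathcal{I}\}$. For a Boolean algebra $\mathbb{B}$, $\mathbb{B}^+=\mathbb{B}\setminus\{0\}$; $D\subseteq\mathbb{B}^+$ is dense if every $b\in\mathbb{B}^+$ has some $d\in D$ with $d\leq b$; $\pi(\mathbb{B})$ is the least cardinality of a dense subset; and $h\pi(\mathbb{B})=\min\{\pi(\{b\in\mathbb{B}: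 b\leq a\}): a\in\mathbb{B}^+\}$. For $\mathbb{B}=P(X)/\mathcal{I}$ this equals $\min\{\pi(P(X)/(\mathcal{I}\upharpoonright A)): A\in\mathcal{I}^+\}$.
   Formalization: add(I) is taken as the least cardinality of a subfamily of I whose union is not in I; the stated "least κ such that I is not κ-complete" is the successor of this cardinal, and with it the claim fails (e.g. for an ideal on ω whose quotient is the Cohen algebra). *)

theory Defs
  imports Main
begin

definition ideal_on :: "'a set \<Rightarrow> 'a set set \<Rightarrow> bool" where
  "ideal_on X I \<longleftrightarrow> I \<subseteq> Pow X
     \<and> (\<forall>A0\<in>I. \<forall>A1\<in>I. \<forall>A. A \<subseteq> A0 \<union> A1 \<longrightarrow> A \<in> I)
     \<and> X \<notin> I \<and> (\<forall>x\<in>X. {x} \<in> I)"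

definition restr :: "'a set \<Rightarrow> 'a set set \<Rightarrow> 'a set \<Rightarrow> 'a set set" where
  "restr X I A = {B. B \<subseteq> X \<and> B \<inter> A \<in> I}"

definition qrel :: "'a set \<Rightarrow> 'a set set \<Rightarrow> ('a set \<times> 'a set) set" where
  "qrel X J = {(B, C). B \<subseteq> X \<and> C \<subseteq> X \<and> B - C \<in> J \<and> C - B \<in> J}"

definition quot :: "'a set \<Rightarrow> 'a set set \<Rightarrow> 'a set set set" where
  "quot X J = Pow X // qrel X J"

definition qzero :: "'a set \<Rightarrow> 'a set set \<Rightarrow> 'a set set" where
  "qzero X J = qrel X J `` {{}}"

definition quot_pos :: "'a set \<Rightarrow> 'a set set \<Rightarrow> 'a set set set" where
  "quot_pos X J = quot X J - {qzero X J}"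

definition qle :: "'a set set \<Rightarrow> 'a set set \<Rightarrow> 'a set set \<Rightarrow> bool" where
  "qle J b c \<longleftrightarrow> (\<exists>B\<in>b. \<exists>C\<in>c. B - C \<in> J)"

definition quot_dense :: "'a set \<Rightarrow> 'a set set \<Rightarrow> 'a set set set \<Rightarrow> bool" where
  "quot_dense X J D \<longleftrightarrow> D \<subseteq> quot_pos X J \<and> (\<forall>b\<in>quot_pos X J. \<exists>d\<in>D. qle J d b)"

definition quot_atomless :: "'a set \<Rightarrow> 'a set set \<Rightarrow> bool" where
  "quot_atomless X J \<longleftrightarrow>
     (\<forall>b\<in>quot_pos X J. \<exists>c\<in>quot_pos X J. qle J c b \<and> \<not> qle J b c)"

end

theory Submission
  imports Defs
begin

text \<open>
  Suppose that all unions of at most \<open>|D|\<close> null sets are null. By atomlessness, the sets of points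
  that lie in exactly the same members of the dense family are null, so at most \<open>2^|D|\<close> null sets
  cover \<open>A\<close>. Let \<open>F\<close> be a smallest family of null sets with non-null union in \<open>A\<close>, and
  \<open>\<kappa> = |F|\<close>, so \<open>|D| < \<kappa> \<le> 2^|D|\<close>. Pushing the ideal forward to \<open>F\<close> gives a \<open>\<kappa>\<close>-complete
  ideal on a set of size \<open>\<kappa>\<close> that still has a dense family \<open>P\<close> with \<open>|P| < \<kappa>\<close>.

  This is impossible. Identify points with subsets of a set \<open>T\<close> with \<open>|T| < \<kappa>\<close>. By
  diagonalisation there are more than \<open>\<kappa>\<close> functions that differ pairwise almost everywhere.
  A category argument with \<open>P\<close> as a forcing notion attaches to each function \<open>\<phi>\<close> a small set
  \<open>C\<close> that avoids a null set \<open>N \<phi>\<close> and meets every intersection of \<open>|P|\<close> dense open sets; hence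
  \<open>\<kappa>\<close> of the functions, say \<open>h x\<close>, have \<open>C\<close> and its image below the same \<open>\<beta>\<close>. Since the
  functions differ, below every member of \<open>P\<close> and for densely many \<open>E\<close>, two positive sets of
  indices force opposite values of some coordinate of \<open>h x\<close> on \<open>E\<close>. So for \<open>s\<close> generic for these
  dense sets, \<open>h x s = v\<close> holds for few \<open>x\<close> only, whereas fewer than \<open>\<kappa>\<close> pairs
  \<open>(s, v)\<close> below \<open>\<beta>\<close> would have to serve all \<open>x\<close>.
\<close>

unbundle cardinal_syntax

section \<open>Complete ideals with a small dense family\<close>

locale ideal_with_small_density =
  fixes K :: "'k set" and I P :: "'k set set"
  assumes down: "A \<in> I \<Longrightarrow> B \<subseteq> A \<Longrightarrow> B \<in> I"
    and union: "A \<in> I \<Longrightarrow> B \<in> I \<Longrightarrow> A \<union> B \<in> I"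
    and Union: "F \<subseteq> I \<Longrightarrow> |F| <o |K| \<Longrightarrow> \<Union>F \<in> I"
    and singleton: "x \<in> K \<Longrightarrow> {x} \<in> I"
    and proper: "K \<notin> I"
    and dense_small: "|P| <o |K|"
    and dense_sub: "E \<in> P \<Longrightarrow> E \<subseteq> K"
    and dense_pos: "E \<in> P \<Longrightarrow> E \<notin> I"
    and dense: "Z \<subseteq> K \<Longrightarrow> Z \<notin> I \<Longrightarrow> \<exists>E\<in>P. E - Z \<in> I"
begin

lemma empty_in: "{} \<in> I"
proof -
  have "K \<noteq> {}"
  proof
    assume "K = {}"
    then have "\<not> |P| <o |K|"
      by (metis card_of_empty not_ordLess_ordLeq)
    with dense_small show False by blast
  qed
  then show ?thesis using singleton down by blast
qed

lemma finite_in: "finite S \<Longrightarrow> S \<subseteq> K \<Longrightarrow> S \<in> I"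
proof (induction rule: finite_induct)
  case empty
  show ?case by (rule empty_in)
next
  case (insert x F)
  then show ?case using union[OF singleton[of x], of F] by auto
qed

lemma infinite_K: "infinite K"
  using finite_in proper by blast

lemma UN: "|T| <o |K| \<Longrightarrow> (\<And>t. t \<in> T \<Longrightarrow> f t \<in> I) \<Longrightarrow> (\<Union>t\<in>T. f t) \<in> I"
  by (rule Union) (auto intro: ordLeq_ordLess_trans[OF card_of_image])

lemma small_in: "S \<subseteq> K \<Longrightarrow> |S| <o |K| \<Longrightarrow> S \<in> I"
  using UN[of S "\<lambda>x. {x}"] singleton by auto

lemma pigeonhole:
  assumes "S \<notin> I" "|T| <o |K|" "\<And>x. x \<in> S \<Longrightarrow> \<exists>t\<in>T. R x t"
  shows "\<exists>t\<in>T. {x \<in> S. R x t} \<notin> I"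
proof (rule ccontr)
  assume "\<not> ?thesis"
  then have "(\<Union>t\<in>T. {x \<in> S. R x t}) \<in> I"
    using UN[OF assms(2), of "\<lambda>t. {x \<in> S. R x t}"] by blast
  moreover have "S \<subseteq> (\<Union>t\<in>T. {x \<in> S. R x t})"
    using assms(3) by blast
  ultimately show False using assms(1) down by blast
qed

text \<open>Fixing one parameter after the other avoids computing the cardinal of a product.\<close>

lemma pigeonhole2:
  assumes "S \<notin> I" "|T| <o |K|" "|T'| <o |K|" "\<And>x. x \<in> S \<Longrightarrow> \<exists>t\<in>T. \<exists>t'\<in>T'. R x t t'"
  shows "\<exists>t\<in>T. \<exists>t'\<in>T'. {x \<in> S. R x t t'} \<notin> I"
proof -
  have "\<exists>t\<in>T. {x \<in> S. \<exists>t'\<in>T'. R x t t'} \<notin> I"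
    by (rule pigeonhole[OF assms(1,2,4)])
  then obtain t where t: "t \<in> T" "{x \<in> S. \<exists>t'\<in>T'. R x t t'} \<notin> I" by blast
  have "\<exists>t'\<in>T'. {x \<in> {x \<in> S. \<exists>t'\<in>T'. R x t t'}. R x t t'} \<notin> I"
    by (rule pigeonhole[OF t(2) assms(3)]) blast
  then obtain t' where t': "t' \<in> T'" "{x \<in> {x \<in> S. \<exists>t'\<in>T'. R x t t'}. R x t t'} \<notin> I" by blast
  then have "{x \<in> S. R x t t'} \<notin> I"
    by (rule_tac notI) (erule notE, erule down, blast)
  then show ?thesis using t(1) t'(1) by blast
qed

lemma pigeonhole3:
  assumes "S \<notin> I" "|T| <o |K|" "|T'| <o |K|" "|T''| <o |K|"
    and "\<And>x. x \<in> S \<Longrightarrow> \<exists>t\<in>T. \<exists>t'\<in>T'. \<exists>t''\<in>T''. R x t t' t''"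
  shows "\<exists>t\<in>T. \<exists>t'\<in>T'. \<exists>t''\<in>T''. {x \<in> S. R x t t' t''} \<notin> I"
proof -
  have "\<exists>t\<in>T. \<exists>t'\<in>T'. {x \<in> S. \<exists>t''\<in>T''. R x t t' t''} \<notin> I"
    by (rule pigeonhole2[OF assms(1-3,5)])
  then obtain t t' where t: "t \<in> T" "t' \<in> T'" "{x \<in> S. \<exists>t''\<in>T''. R x t t' t''} \<notin> I" by blast
  have "\<exists>t''\<in>T''. {x \<in> {x \<in> S. \<exists>t''\<in>T''. R x t t' t''}. R x t t' t''} \<notin> I"
    by (rule pigeonhole[OF t(3) assms(4)]) blast
  then obtain t'' where t'': "t'' \<in> T''"
    "{x \<in> {x \<in> S. \<exists>t''\<in>T''. R x t t' t''}. R x t t' t''} \<notin> I" by blast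
  then have "{x \<in> S. R x t t' t''} \<notin> I"
    by (rule_tac notI) (erule notE, erule down, blast)
  then show ?thesis using t(1,2) t''(1) by blast
qed

lemma dense_meet:
  assumes "E \<in> P" "E - A \<in> I" "E - B \<in> I"
  shows "\<exists>x\<in>E. x \<in> A \<and> x \<in> B"
proof (rule ccontr)
  assume "\<not> ?thesis"
  then have "E \<subseteq> (E - A) \<union> (E - B)" by blast
  then show False using down[OF union[OF assms(2,3)]] dense_pos[OF assms(1)] by blast
qed

lemma diff_trans: "A - B \<in> I \<Longrightarrow> B - C \<in> I \<Longrightarrow> A - C \<in> I"
  by (rule down[OF union[of "A - B" "B - C"]]) auto

text \<open>\<open>|K|\<close> is a well-order of \<open>K\<close> of least type, so each proper
  initial segment is smaller than \<open>K\<close> and therefore null.\<close>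

abbreviation below :: "'k \<Rightarrow> 'k set" where
  "below \<equiv> underS |K|"

lemma below_sub: "below x \<subseteq> K"
  using Order_Relation.underS_Field[of "|K|" x] by (simp add: Field_card_of)

lemma below_small: "x \<in> K \<Longrightarrow> |below x| <o |K|"
  using card_of_underS[OF card_of_Card_order, of x K] by (simp add: Field_card_of)

lemma below_total: "x \<in> K \<Longrightarrow> y \<in> K \<Longrightarrow> x \<in> below y \<or> y \<in> insert x (below x)"
  using wo_rel.TOTALS[of "|K|"] card_of_Well_order[of K]
  by (auto simp: underS_def Field_card_of wo_rel_def)

lemma upto_in: "x \<in> K \<Longrightarrow> insert x (below x) \<in> I"
  using union[OF singleton[of x] small_in[of "below x"]] below_sub below_small by auto

lemma above_pos:
  assumes "S \<subseteq> K" "S \<notin> I" "x \<in> K"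
  shows "{y \<in> S. x \<in> below y} \<notin> I"
proof
  assume "{y \<in> S. x \<in> below y} \<in> I"
  then have "{y \<in> S. x \<in> below y} \<union> insert x (below x) \<in> I"
    using union upto_in assms(3) by blast
  moreover have "S \<subseteq> {y \<in> S. x \<in> below y} \<union> insert x (below x)"
    using below_total assms(1,3) by blast
  ultimately show False using down assms(2) by blast
qed

text \<open>This is regularity of \<open>|K|\<close>, and it comes from the ideal: if
  \<open>C\<close> were unbounded, the null initial segments up to its points would cover
  \<open>K\<close>.\<close>

lemma small_bounded:
  assumes "C \<subseteq> K" "|C| <o |K|"
  shows "\<exists>b\<in>K. C \<subseteq> below b"
proof (rule ccontr)
  assume contra: "\<not> ?thesis"
  have "K \<subseteq> (\<Union>c\<in>C. insert c (below c))"
  proof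
    fix b assume b: "b \<in> K"
    then obtain c where c: "c \<in> C" "c \<notin> below b" using contra by blast
    then have "b \<in> insert c (below c)" using below_total[of c b] assms(1) b by blast
    then show "b \<in> (\<Union>c\<in>C. insert c (below c))" using c(1) by blast
  qed
  moreover have "(\<Union>c\<in>C. insert c (below c)) \<in> I"
    by (rule UN[OF assms(2)], rule upto_in) (use assms(1) in blast)
  ultimately show False using down proper by blast
qed

section \<open>Category with respect to the dense family\<close>

text \<open>
  \<open>P\<close> is ordered by inclusion modulo \<open>I\<close>. A point \<open>s\<close> meets \<open>U\<close> if it lies in a member of \<open>U\<close>
  (not merely almost), so these notions depend on the choice of representatives in \<open>P\<close>.
\<close>

definition dense_in :: "'k set set \<Rightarrow> bool" where
  "dense_in U \<longleftrightarrow> U \<subseteq> P \<and> (\<forall>E\<in>P. \<exists>E'\<in>U. E' - E \<in> I)"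

definition nonmeager :: "'k set \<Rightarrow> bool" where
  "nonmeager C \<longleftrightarrow> (\<forall>U. (\<forall>i\<in>P. dense_in (U i)) \<longrightarrow> (\<exists>s\<in>C. \<forall>i\<in>P. s \<in> \<Union>(U i)))"

text \<open>Otherwise each \<open>x\<close> has families \<open>U x\<close> such that every
  \<open>s\<close> in \<open>below x - N\<close> misses one of them. Interchanging the roles of
  \<open>s\<close> and \<open>x\<close> refutes this: for fixed \<open>i\<close>, missing holds for
  positively many \<open>s\<close> and almost all \<open>x\<close> in some \<open>b\<close>, while
  density of \<open>U x i\<close> forces meeting for positively many \<open>x\<close> in
  \<open>b\<close>.\<close>

lemma small_nonmeager:
  assumes "N \<in> I"
  shows "\<exists>C \<subseteq> K - N. |C| <o |K| \<and> nonmeager C"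
proof (rule ccontr)
  assume contra: "\<not> ?thesis"
  have "\<forall>x\<in>K. \<exists>U. (\<forall>i\<in>P. dense_in (U i)) \<and> (\<forall>s\<in>below x - N. \<exists>i\<in>P. s \<notin> \<Union>(U i))"
  proof (intro ballI)
    fix x assume "x \<in> K"
    then have "|below x - N| <o |K|"
      using below_small card_of_mono1[of "below x - N" "below x"] ordLeq_ordLess_trans by blast
    moreover have "below x - N \<subseteq> K - N" using below_sub by blast
    ultimately have "\<not> nonmeager (below x - N)" using contra by blast
    then show "\<exists>U. (\<forall>i\<in>P. dense_in (U i)) \<and> (\<forall>s\<in>below x - N. \<exists>i\<in>P. s \<notin> \<Union>(U i))"
      unfolding nonmeager_def by blast
  qed
  from bchoice[OF this] obtain U where U: "\<And>x i. x \<in> K \<Longrightarrow> i \<in> P \<Longrightarrow> dense_in (U x i)"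
    and miss: "\<And>x s. x \<in> K \<Longrightarrow> s \<in> below x \<Longrightarrow> s \<notin> N \<Longrightarrow> \<exists>i\<in>P. s \<notin> \<Union>(U x i)"
    by blast
  have "\<exists>i\<in>P. \<exists>b\<in>P. b - {x \<in> K. s \<notin> \<Union>(U x i)} \<in> I" if s: "s \<in> K - N" for s
  proof -
    \<comment> \<open>Positively many \<open>x\<close> lie above \<open>s\<close>, so one
      \<open>i\<close> serves positively many of them.\<close>
    have "\<exists>i\<in>P. {x \<in> {x \<in> K. s \<in> below x}. s \<notin> \<Union>(U x i)} \<notin> I"
      using s miss by (intro pigeonhole above_pos dense_small proper) auto
    then obtain i where i: "i \<in> P" "{x \<in> {x \<in> K. s \<in> below x}. s \<notin> \<Union>(U x i)} \<notin> I"
      by blast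
    then have "{x \<in> K. s \<notin> \<Union>(U x i)} \<notin> I"
      by (rule_tac notI) (erule notE, erule down, auto)
    then show ?thesis using dense[of "{x \<in> K. s \<notin> \<Union>(U x i)}"] i(1) by blast
  qed
  moreover have "K - N \<notin> I"
    using assms proper union[of "K - N" N] down[of "K - N \<union> N" K] by blast
  ultimately have "\<exists>i\<in>P. \<exists>b\<in>P. {s \<in> K - N. b - {x \<in> K. s \<notin> \<Union>(U x i)} \<in> I} \<notin> I"
    by (intro pigeonhole2 dense_small)
  then obtain i b where i: "i \<in> P" and b: "b \<in> P"
    and S: "{s \<in> K - N. b - {x \<in> K. s \<notin> \<Union>(U x i)} \<in> I} \<notin> I" by blast
  define S where "S = {s \<in> K - N. b - {x \<in> K. s \<notin> \<Union>(U x i)} \<in> I}"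
  then obtain e where e: "e \<in> P" "e - S \<in> I"
    using dense[of S] S unfolding S_def by blast
  \<comment> \<open>Density of \<open>U x i\<close> gives a member below \<open>e\<close>; since
    \<open>P\<close> is small, the same \<open>e'\<close> serves positively many \<open>x\<close> in
    \<open>b\<close>.\<close>
  have "\<exists>e'\<in>P. e' \<in> U x i \<and> e' - e \<in> I" if "x \<in> b" for x
    using U[of x i] that dense_sub[OF b] i e(1) unfolding dense_in_def by blast
  then have "\<exists>e'\<in>P. {x \<in> b. e' \<in> U x i \<and> e' - e \<in> I} \<notin> I"
    by (rule pigeonhole[OF dense_pos[OF b] dense_small])
  then obtain e' where e': "e' \<in> P" "{x \<in> b. e' \<in> U x i \<and> e' - e \<in> I} \<notin> I" by blast
  then have "e' - e \<in> I" using empty_in by (metis (mono_tags, lifting) Collect_empty_eq)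
  then have "e' - S \<in> I" using diff_trans e(2) by blast
  then obtain s where s: "s \<in> e'" "s \<in> S" using dense_meet[OF e'(1)] by blast
  \<comment> \<open>For these \<open>x\<close> the point \<open>s\<close> of \<open>e'\<close> meets
    \<open>U x i\<close>, but \<open>s\<close> in \<open>S\<close> says that almost every
    \<open>x\<close> in \<open>b\<close> has \<open>s\<close> missing it.\<close>
  have "{x \<in> b. e' \<in> U x i \<and> e' - e \<in> I} \<subseteq> b - {x \<in> K. s \<notin> \<Union>(U x i)}"
    using s(1) by blast
  then show False using s(2) e'(2) down unfolding S_def by blast
qed

section \<open>Functions that pairwise differ almost everywhere\<close>

text \<open>A maximal such family is larger than \<open>K\<close>: an indexing \<open>m\<close> by
  \<open>K\<close> could be diagonalised, where the new function at \<open>y\<close> avoids only the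
  functions with index below \<open>y\<close>, which are too few to take all values.\<close>

lemma many_different_functions:
  "\<exists>\<Phi>. (\<forall>\<phi>\<in>\<Phi>. \<phi> ` K \<subseteq> K) \<and> (\<forall>\<phi>\<in>\<Phi>. \<forall>\<psi>\<in>\<Phi>. \<phi> \<noteq> \<psi> \<longrightarrow> {y \<in> K. \<phi> y = \<psi> y} \<in> I)
     \<and> |K| <o |\<Phi>|"
proof -
  define A where "A = {\<Phi> :: ('k \<Rightarrow> 'k) set. (\<forall>\<phi>\<in>\<Phi>. \<phi> ` K \<subseteq> K) \<and>
    (\<forall>\<phi>\<in>\<Phi>. \<forall>\<psi>\<in>\<Phi>. \<phi> \<noteq> \<psi> \<longrightarrow> {y \<in> K. \<phi> y = \<psi> y} \<in> I)}"
  have "\<Union>c \<in> A" if c: "subset.chain A c" for c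
  proof -
    have cA: "\<Phi> \<in> A" if "\<Phi> \<in> c" for \<Phi>
      using c that unfolding subset_chain_def by blast
    have "{y \<in> K. \<phi> y = \<psi> y} \<in> I" if \<phi>\<psi>: "\<phi> \<in> \<Union>c" "\<psi> \<in> \<Union>c" "\<phi> \<noteq> \<psi>" for \<phi> \<psi>
    proof -
      obtain \<Phi> \<Psi> where "\<Phi> \<in> c" "\<phi> \<in> \<Phi>" "\<Psi> \<in> c" "\<psi> \<in> \<Psi>"
        using \<phi>\<psi>(1,2) by blast
      moreover from this have "\<Phi> \<subseteq> \<Psi> \<or> \<Psi> \<subseteq> \<Phi>"
        using c unfolding subset_chain_def by blast
      ultimately obtain \<Theta> where "\<Theta> \<in> c" "\<phi> \<in> \<Theta>" "\<psi> \<in> \<Theta>" by blast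
      then show ?thesis using cA[of \<Theta>] \<phi>\<psi>(3) unfolding A_def mem_Collect_eq by blast
    qed
    moreover have "\<phi> ` K \<subseteq> K" if "\<phi> \<in> \<Union>c" for \<phi>
      using cA that unfolding A_def by blast
    ultimately show ?thesis unfolding A_def mem_Collect_eq by (intro conjI ballI impI)
  qed
  from subset_Zorn'[of A, OF this] obtain \<Phi> where \<Phi>: "\<Phi> \<in> A"
    and max: "\<And>\<Psi>. \<Psi> \<in> A \<Longrightarrow> \<Phi> \<subseteq> \<Psi> \<Longrightarrow> \<Psi> = \<Phi>"
    by blast
  have "\<not> |\<Phi>| \<le>o |K|"
  proof
    assume "|\<Phi>| \<le>o |K|"
    then obtain m where m: "inj_on m \<Phi>" "m ` \<Phi> \<subseteq> K"
      unfolding card_of_ordLeq[symmetric] by blast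
    have "\<exists>z\<in>K. \<forall>\<phi>\<in>\<Phi>. m \<phi> \<in> below y \<longrightarrow> \<phi> y \<noteq> z" if y: "y \<in> K" for y
    proof (rule ccontr)
      assume "\<not> ?thesis"
      then have "K \<subseteq> (\<lambda>\<phi>. \<phi> y) ` {\<phi> \<in> \<Phi>. m \<phi> \<in> below y}" by (auto simp: image_iff)
      then have "|K| \<le>o |{\<phi> \<in> \<Phi>. m \<phi> \<in> below y}|"
        using card_of_image card_of_mono1 ordLeq_transitive by blast
      also have "|{\<phi> \<in> \<Phi>. m \<phi> \<in> below y}| \<le>o |below y|"
        unfolding card_of_ordLeq[symmetric] using m(1)
        by (intro exI[of _ m]) (auto intro: inj_on_subset)
      finally show False using below_small[OF y] not_ordLess_ordLeq by blast
    qed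
    then obtain \<psi> where \<psi>: "\<And>y. y \<in> K \<Longrightarrow> \<psi> y \<in> K"
      "\<And>y \<phi>. y \<in> K \<Longrightarrow> \<phi> \<in> \<Phi> \<Longrightarrow> m \<phi> \<in> below y \<Longrightarrow> \<phi> y \<noteq> \<psi> y"
      by metis
    have diff: "{y \<in> K. \<phi> y = \<psi> y} \<in> I" if "\<phi> \<in> \<Phi>" for \<phi>
    proof -
      have "m \<phi> \<in> K" using m(2) that by blast
      moreover have "{y \<in> K. \<phi> y = \<psi> y} \<subseteq> insert (m \<phi>) (below (m \<phi>))"
        using \<psi>(2)[OF _ that] below_total[OF \<open>m \<phi> \<in> K\<close>] by blast
      ultimately show ?thesis using upto_in down by blast
    qed
    then have "insert \<psi> \<Phi> \<in> A"
      using \<Phi> \<psi>(1) unfolding A_def by (auto simp: eq_commute)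
    then have "\<psi> \<in> \<Phi>" using max by blast
    \<comment> \<open>Now \<open>diff\<close> applies to \<open>\<psi>\<close> itself and makes
      \<open>K\<close> null.\<close>
    then show False using diff proper by fastforce
  qed
  then have "|K| <o |\<Phi>|"
    by (rule not_ordLeq_iff_ordLess[OF card_of_Well_order card_of_Well_order, THEN iffD1])
  then show ?thesis using \<Phi> unfolding A_def by blast
qed

section \<open>Forcing coordinates of functions\<close>

text \<open>This is forcing with \<open>P\<close>: the condition \<open>E\<close> settles whether
  \<open>t\<close> belongs to the value of \<open>f\<close> at a generic point.\<close>

definition decides :: "('k \<Rightarrow> 'b set) \<Rightarrow> 'b \<Rightarrow> bool \<Rightarrow> 'k set \<Rightarrow> bool" where
  "decides f t c E \<longleftrightarrow> E - {y. (t \<in> f y) = c} \<in> I"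

definition deciders :: "('k \<Rightarrow> 'k \<Rightarrow> 'b set) \<Rightarrow> 'b \<Rightarrow> bool \<Rightarrow> 'k set \<Rightarrow> 'k set" where
  "deciders f t c E = {x. decides (f x) t c E}"

lemma bool_small: "|UNIV :: bool set| <o |K|"
  using finite_ordLess_infinite[OF card_of_Well_order card_of_Well_order, of "UNIV :: bool set" K] infinite_K
  by (simp add: Field_card_of)

text \<open>Where \<open>f\<close> and \<open>g\<close> differ, some coordinate in \<open>T\<close>
  separates their values. Completeness makes the coordinate and its direction \<open>c\<close>
  constant on a positive subset of \<open>E\<^sub>0\<close>, and a member of \<open>P\<close> lies
  almost inside that subset.\<close>

lemma decide_difference:
  assumes "E\<^sub>0 \<in> P" "|T| <o |K|" "{y \<in> K. f y = g y} \<in> I"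
    and "\<And>y. y \<in> K \<Longrightarrow> f y \<subseteq> T" "\<And>y. y \<in> K \<Longrightarrow> g y \<subseteq> T"
  shows "\<exists>t\<in>T. \<exists>c\<in>UNIV. \<exists>E\<in>P. E - E\<^sub>0 \<in> I \<and> decides f t c E \<and> decides g t (\<not> c) E"
proof -
  have "{y \<in> E\<^sub>0. f y \<noteq> g y} \<notin> I"
  proof
    assume "{y \<in> E\<^sub>0. f y \<noteq> g y} \<in> I"
    from union[OF this assms(3)] have "E\<^sub>0 \<in> I"
      by (rule down) (use dense_sub[OF assms(1)] in blast)
    then show False using dense_pos assms(1) by blast
  qed
  moreover have "\<exists>t\<in>T. \<exists>c\<in>UNIV. (t \<in> f y) = c \<and> (t \<in> g y) = (\<not> c)"
    if "y \<in> {y \<in> E\<^sub>0. f y \<noteq> g y}" for y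
  proof -
    have "y \<in> K" "f y \<noteq> g y" using that dense_sub[OF assms(1)] by auto
    then show ?thesis using assms(4,5)[of y] by blast
  qed
  ultimately have "\<exists>t\<in>T. \<exists>c\<in>UNIV.
      {y \<in> {y \<in> E\<^sub>0. f y \<noteq> g y}. (t \<in> f y) = c \<and> (t \<in> g y) = (\<not> c)} \<notin> I"
    by (rule pigeonhole2[OF _ assms(2) bool_small])
  then obtain t c where t: "t \<in> T"
    and S: "{y \<in> {y \<in> E\<^sub>0. f y \<noteq> g y}. (t \<in> f y) = c \<and> (t \<in> g y) = (\<not> c)} \<notin> I" (is "?S \<notin> I")
    by blast
  obtain E where E: "E \<in> P" "E - ?S \<in> I"
    using dense[OF _ S] dense_sub[OF assms(1)] by blast
  have "E - E\<^sub>0 \<in> I" "decides f t c E" "decides g t (\<not> c) E"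
    unfolding decides_def by (rule down[OF E(2)], blast)+
  then show ?thesis using t E(1) by blast
qed

text \<open>\<open>decide_difference\<close> handles one pair of indices. Stabilising its outcome
  first over \<open>x\<close> with \<open>x'\<close> fixed, then over \<open>x'\<close>, yields the
  two sets of indices with opposite decisions.\<close>

lemma decide_oppositely:
  assumes b: "b \<in> P" and E\<^sub>0: "E\<^sub>0 \<in> P" and T: "|T| <o |K|"
    and sub: "\<And>x y. x \<in> K \<Longrightarrow> y \<in> K \<Longrightarrow> f x y \<subseteq> T"
    and diff: "\<And>x x'. x \<in> K \<Longrightarrow> x' \<in> K \<Longrightarrow> x \<noteq> x' \<Longrightarrow> {y \<in> K. f x y = f x' y} \<in> I"
  shows "\<exists>E\<in>P. E - E\<^sub>0 \<in> I \<and> (\<exists>t\<in>T. \<exists>c. \<exists>b\<^sub>1\<in>P. \<exists>b\<^sub>2\<in>P. b\<^sub>1 - b \<in> I \<and> b\<^sub>2 - b \<in> I \<and>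
    b\<^sub>1 - deciders f t c E \<in> I \<and> b\<^sub>2 - deciders f t (\<not> c) E \<in> I)"
proof -
  \<comment> \<open>\<open>G\<close> records the outcome of the first round for one
    \<open>x'\<close>; here \<open>b\<^sub>1\<close> may still depend on \<open>x'\<close>.\<close>
  define G where "G = (\<lambda>x' t c E. E - E\<^sub>0 \<in> I \<and> decides (f x') t (\<not> c) E \<and>
    (\<exists>b\<^sub>1\<in>P. b\<^sub>1 - b \<in> I \<and> b\<^sub>1 - deciders f t c E \<in> I))"
  have "\<exists>t\<in>T. \<exists>c\<in>UNIV. \<exists>E\<in>P. G x' t c E" if x': "x' \<in> b" for x'
  proof -
    have x'K: "x' \<in> K" using x' dense_sub[OF b] by blast
    have "b - {x'} \<notin> I"
    proof
      assume "b - {x'} \<in> I"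
      from union[OF this singleton[OF x'K]] have "b \<in> I" by (rule down) blast
      then show False using dense_pos b by blast
    qed
    moreover have "\<exists>t\<in>T. \<exists>c\<in>UNIV. \<exists>E\<in>P. E - E\<^sub>0 \<in> I \<and> decides (f x) t c E \<and> decides (f x') t (\<not> c) E"
      if "x \<in> b - {x'}" for x
      using that dense_sub[OF b] x'K by (intro decide_difference[OF E\<^sub>0 T diff] sub) blast+
    ultimately have "\<exists>t\<in>T. \<exists>c\<in>UNIV. \<exists>E\<in>P.
      {x \<in> b - {x'}. E - E\<^sub>0 \<in> I \<and> decides (f x) t c E \<and> decides (f x') t (\<not> c) E} \<notin> I"
      by (rule pigeonhole3[OF _ T bool_small dense_small])
    then obtain t c E where t: "t \<in> T" "E \<in> P"
      and S: "{x \<in> b - {x'}. E - E\<^sub>0 \<in> I \<and> decides (f x) t c E \<and> decides (f x') t (\<not> c) E} \<notin> I"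
        (is "?S \<notin> I")
      by blast
    obtain b\<^sub>1 where b1: "b\<^sub>1 \<in> P" "b\<^sub>1 - ?S \<in> I"
      using dense[OF _ S] dense_sub[OF b] by blast
    have "b\<^sub>1 - b \<in> I" "b\<^sub>1 - deciders f t c E \<in> I"
      unfolding deciders_def by (rule down[OF b1(2)], blast)+
    moreover have "?S \<noteq> {}" using S empty_in by metis
    then have "E - E\<^sub>0 \<in> I \<and> decides (f x') t (\<not> c) E" by blast
    ultimately have "G x' t c E" unfolding G_def using b1(1) by blast
    then show ?thesis using t by blast
  qed
  then have "\<exists>t\<in>T. \<exists>c\<in>UNIV. \<exists>E\<in>P. {x' \<in> b. G x' t c E} \<notin> I"
    by (rule pigeonhole3[OF dense_pos[OF b] T bool_small dense_small])
  then obtain t c E where t: "t \<in> T" "E \<in> P" and S: "{x' \<in> b. G x' t c E} \<notin> I"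
    by blast
  obtain b\<^sub>2 where b2: "b\<^sub>2 \<in> P" "b\<^sub>2 - {x' \<in> b. G x' t c E} \<in> I"
    using dense[OF _ S] dense_sub[OF b] by blast
  have "b\<^sub>2 - b \<in> I" by (rule down[OF b2(2)]) blast
  moreover have "b\<^sub>2 - deciders f t (\<not> c) E \<in> I"
    by (rule down[OF b2(2)]) (auto simp: G_def deciders_def)
  \<comment> \<open>Any single \<open>x'\<close> supplies \<open>b\<^sub>1\<close>, since
    \<open>t\<close>, \<open>c\<close> and \<open>E\<close> no longer depend on it.\<close>
  moreover have "{x' \<in> b. G x' t c E} \<noteq> {}" using S empty_in by metis
  then obtain x' where "G x' t c E" by blast
  then obtain b\<^sub>1 where "E - E\<^sub>0 \<in> I" "b\<^sub>1 \<in> P" "b\<^sub>1 - b \<in> I" "b\<^sub>1 - deciders f t c E \<in> I"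
    unfolding G_def by blast
  ultimately show ?thesis using t b2(1) by blast
qed

section \<open>The strong limit property of \<open>|K|\<close>\<close>

lemma not_le_Pow:
  assumes T: "|T| <o |K|"
  shows "\<not> |K| \<le>o |Pow T|"
proof
  assume "|K| \<le>o |Pow T|"
  then obtain \<tau> where \<tau>: "inj_on \<tau> K" "\<tau> ` K \<subseteq> Pow T"
    unfolding card_of_ordLeq[symmetric] by blast
  obtain \<Phi> where \<Phi>: "\<forall>\<phi>\<in>\<Phi>. \<phi> ` K \<subseteq> K"
      "\<forall>\<phi>\<in>\<Phi>. \<forall>\<psi>\<in>\<Phi>. \<phi> \<noteq> \<psi> \<longrightarrow> {y \<in> K. \<phi> y = \<psi> y} \<in> I"
    and \<Phi>card: "|K| <o |\<Phi>|"
    using many_different_functions by (elim exE conjE)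
  have \<Phi>K: "\<phi> ` K \<subseteq> K" if "\<phi> \<in> \<Phi>" for \<phi>
    using bspec[OF \<Phi>(1) that] .
  have \<Phi>diff: "{y \<in> K. \<phi> y = \<psi> y} \<in> I" if "\<phi> \<in> \<Phi>" "\<psi> \<in> \<Phi>" "\<phi> \<noteq> \<psi>" for \<phi> \<psi>
    using bspec[OF bspec[OF \<Phi>(2) that(1)] that(2)] that(3) by (rule mp)
  \<comment> \<open>Outside \<open>N \<phi>\<close>, what \<open>E\<close> decides almost everywhere about \<open>\<tau> \<circ> \<phi>\<close> holds at every point of \<open>E\<close>.\<close>
  define N where "N = (\<lambda>\<phi>. \<Union>t\<in>T. \<Union>c\<in>UNIV. \<Union>E\<in>P.
    if decides (\<tau> \<circ> \<phi>) t c E then E - {y. (t \<in> \<tau> (\<phi> y)) = c} else {})"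
  have N: "N \<phi> \<in> I" for \<phi>
    unfolding N_def by (intro UN T bool_small dense_small) (simp add: decides_def empty_in)
  have N_decides: "(t \<in> \<tau> (\<phi> s)) = c"
    if "s \<notin> N \<phi>" "decides (\<tau> \<circ> \<phi>) t c E" "t \<in> T" "E \<in> P" "s \<in> E" for \<phi> s t c E
    using that unfolding N_def by auto
  define Q where "Q = (\<lambda>\<phi> \<beta>. \<exists>C. C \<subseteq> below \<beta> - N \<phi> \<and> \<phi> ` C \<subseteq> below \<beta> \<and> nonmeager C)"
  have Q: "\<exists>\<beta>\<in>K. Q \<phi> \<beta>" if \<phi>: "\<phi> \<in> \<Phi>" for \<phi>
  proof -
    obtain C where C: "C \<subseteq> K - N \<phi>" "|C| <o |K|" "nonmeager C"
      using small_nonmeager[OF N] by blast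
    have "|C \<union> \<phi> ` C| <o |K|"
      using card_of_Un_ordLess_infinite[OF infinite_K C(2) ordLeq_ordLess_trans[OF card_of_image C(2)]] .
    moreover have "C \<union> \<phi> ` C \<subseteq> K" using C(1) \<Phi>K[OF \<phi>] by blast
    ultimately obtain \<beta> where "\<beta> \<in> K" "C \<union> \<phi> ` C \<subseteq> below \<beta>"
      using small_bounded by blast
    then show ?thesis unfolding Q_def using C by blast
  qed
  \<comment> \<open>Otherwise \<open>\<Phi>\<close> would be a union of \<open>|K|\<close> sets of
    size at most \<open>|K|\<close>, against its size.\<close>
  have "\<exists>\<beta>\<in>K. |K| \<le>o |{\<phi> \<in> \<Phi>. Q \<phi> \<beta>}|"
  proof (rule ccontr)
    assume contra: "\<not> ?thesis"
    have "|{\<phi> \<in> \<Phi>. Q \<phi> \<beta>}| \<le>o |K|" if "\<beta> \<in> K" for \<beta>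
      using contra that ordLeq_total[OF card_of_Well_order card_of_Well_order, of "{\<phi> \<in> \<Phi>. Q \<phi> \<beta>}" K]
      by blast
    then have "|\<Union>\<beta>\<in>K. {\<phi> \<in> \<Phi>. Q \<phi> \<beta>}| \<le>o |K|"
      by (intro card_of_UNION_ordLeq_infinite[OF infinite_K card_of_mono1] ballI subset_refl)
    moreover have "\<Phi> \<subseteq> (\<Union>\<beta>\<in>K. {\<phi> \<in> \<Phi>. Q \<phi> \<beta>})"
      using Q by blast
    ultimately have "|\<Phi>| \<le>o |K|"
      using ordLeq_transitive[OF card_of_mono1] by blast
    then show False using not_ordLess_ordLeq[OF \<Phi>card] by blast
  qed
  then obtain \<beta> where \<beta>: "\<beta> \<in> K" "|K| \<le>o |{\<phi> \<in> \<Phi>. Q \<phi> \<beta>}|" by blast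
  then obtain h where h: "inj_on h K" "h ` K \<subseteq> {\<phi> \<in> \<Phi>. Q \<phi> \<beta>}"
    unfolding card_of_ordLeq[symmetric] by blast
  have h\<Phi>: "h x \<in> \<Phi>" if "x \<in> K" for x using h(2) that by blast
  have hK: "h x y \<in> K" if "x \<in> K" "y \<in> K" for x y using \<Phi>K[OF h\<Phi>] that by blast
  define f where "f = (\<lambda>x. \<tau> \<circ> h x)"
  have f_sub: "f x y \<subseteq> T" if "x \<in> K" "y \<in> K" for x y
    using \<tau>(2) hK[OF that] unfolding f_def by auto
  have f_diff: "{y \<in> K. f x y = f x' y} \<in> I" if "x \<in> K" "x' \<in> K" "x \<noteq> x'" for x x'
  proof -
    have "h x \<noteq> h x'" using h(1) that by (meson inj_onD)
    then have "{y \<in> K. h x y = h x' y} \<in> I" using \<Phi>diff h\<Phi> that by blast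
    moreover have "{y \<in> K. f x y = f x' y} \<subseteq> {y \<in> K. h x y = h x' y}"
      using \<tau>(1) hK that unfolding f_def by (auto dest: inj_onD)
    ultimately show ?thesis using down by blast
  qed
  \<comment> \<open>There is one dense family for each \<open>b\<close> in \<open>P\<close>, which
    is the number of families that \<open>nonmeager\<close> meets at once.\<close>
  define W where "W = (\<lambda>b. {E \<in> P. \<exists>t\<in>T. \<exists>c. \<exists>b\<^sub>1\<in>P. \<exists>b\<^sub>2\<in>P. b\<^sub>1 - b \<in> I \<and> b\<^sub>2 - b \<in> I \<and>
    b\<^sub>1 - deciders f t c E \<in> I \<and> b\<^sub>2 - deciders f t (\<not> c) E \<in> I})"
  have W_dense: "dense_in (W b)" if "b \<in> P" for b
    unfolding dense_in_def
  proof (intro conjI ballI)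
    show "W b \<subseteq> P" unfolding W_def by blast
    fix E assume "E \<in> P"
    from decide_oppositely[where f = f, OF that this T f_sub f_diff]
    show "\<exists>E'\<in>W b. E' - E \<in> I" unfolding W_def by blast
  qed
  \<comment> \<open>If this set were positive, it would almost contain some \<open>b\<close>. A
    member \<open>E\<close> of \<open>W b\<close> through \<open>s\<close> then yields two indices
    in the set with opposite decisions on \<open>t\<close>; outside the sets \<open>N\<close> both
    decisions hold at \<open>s\<close>, where both functions take the value
    \<open>v\<close>.\<close>
  have generic: "{x \<in> K. s \<notin> N (h x) \<and> h x s = v} \<in> I"
    if s: "\<forall>b\<in>P. s \<in> \<Union>(W b)" for s v
  proof (rule ccontr)
    let ?Z = "{x \<in> K. s \<notin> N (h x) \<and> h x s = v}"
    assume "?Z \<notin> I"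
    then obtain b where b: "b \<in> P" "b - ?Z \<in> I" using dense[of ?Z] by blast
    then obtain E where "E \<in> W b" "s \<in> E" using s by blast
    then obtain t c b\<^sub>1 b\<^sub>2 where E: "E \<in> P" "t \<in> T" "b\<^sub>1 \<in> P" "b\<^sub>2 \<in> P"
      and le: "b\<^sub>1 - b \<in> I" "b\<^sub>2 - b \<in> I"
      and dec: "b\<^sub>1 - deciders f t c E \<in> I" "b\<^sub>2 - deciders f t (\<not> c) E \<in> I"
      unfolding W_def by blast
    obtain x\<^sub>1 where "x\<^sub>1 \<in> ?Z" "decides (f x\<^sub>1) t c E"
      using dense_meet[OF E(3) diff_trans[OF le(1) b(2)] dec(1)]
      unfolding deciders_def by blast
    then have "(t \<in> \<tau> v) = c"
      using N_decides[of s "h x\<^sub>1" t c E] E(1,2) \<open>s \<in> E\<close> unfolding f_def by blast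
    moreover obtain x\<^sub>2 where "x\<^sub>2 \<in> ?Z" "decides (f x\<^sub>2) t (\<not> c) E"
      using dense_meet[OF E(4) diff_trans[OF le(2) b(2)] dec(2)]
      unfolding deciders_def by blast
    then have "(t \<in> \<tau> v) = (\<not> c)"
      using N_decides[of s "h x\<^sub>2" t "\<not> c" E] E(1,2) \<open>s \<in> E\<close> unfolding f_def by blast
    ultimately show False by blast
  qed
  \<comment> \<open>Every \<open>x\<close> finds its \<open>s\<close> and \<open>v\<close> below the
    common \<open>\<beta>\<close>, so one pair serves positively many \<open>x\<close>, against
    \<open>generic\<close>.\<close>
  have "\<exists>s\<in>below \<beta>. \<exists>v\<in>below \<beta>. (\<forall>b\<in>P. s \<in> \<Union>(W b)) \<and> s \<notin> N (h x) \<and> h x s = v"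
    if "x \<in> K" for x
  proof -
    have "h x \<in> {\<phi> \<in> \<Phi>. Q \<phi> \<beta>}" using h(2) that by blast
    then have "Q (h x) \<beta>" by simp
    then obtain C where C: "C \<subseteq> below \<beta> - N (h x)" "h x ` C \<subseteq> below \<beta>" "nonmeager C"
      unfolding Q_def by (elim exE conjE)
    have "\<exists>s\<in>C. \<forall>b\<in>P. s \<in> \<Union>(W b)"
      using C(3)[unfolded nonmeager_def, rule_format, of W] W_dense by simp
    then obtain s where s: "s \<in> C" "\<forall>b\<in>P. s \<in> \<Union>(W b)" by (elim bexE)
    have "s \<in> below \<beta>" "s \<notin> N (h x)" "h x s \<in> below \<beta>"
      using C(1,2) s(1) by auto
    then show ?thesis using s(2) by (intro bexI[of _ s] bexI[of _ "h x s"] conjI refl)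
  qed
  then have "\<exists>s\<in>below \<beta>. \<exists>v\<in>below \<beta>.
      {x \<in> K. (\<forall>b\<in>P. s \<in> \<Union>(W b)) \<and> s \<notin> N (h x) \<and> h x s = v} \<notin> I"
    by (rule pigeonhole2[OF proper below_small[OF \<beta>(1)] below_small[OF \<beta>(1)]])
  then obtain s v where sv: "{x \<in> K. (\<forall>b\<in>P. s \<in> \<Union>(W b)) \<and> s \<notin> N (h x) \<and> h x s = v} \<notin> I"
    (is "?S \<notin> I") by blast
  then have "?S \<noteq> {}" using empty_in by metis
  then have "\<forall>b\<in>P. s \<in> \<Union>(W b)" by blast
  from generic[OF this, of v] have "?S \<in> I" by (rule down) blast
  then show False using sv by blast
qed

end

section \<open>Transfer to an ideal on a family of null sets\<close>

text \<open>\<open>D\<close> is an index set because it will consist of quotient classes, with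
  \<open>E\<close> choosing representatives.\<close>

lemma incomplete_of_dense_family:
  fixes I :: "'a set set" and E :: "'d \<Rightarrow> 'a set"
  assumes down: "\<And>Y Z. Y \<in> I \<Longrightarrow> Z \<subseteq> Y \<Longrightarrow> Z \<in> I"
    and union: "\<And>Y Z. Y \<in> I \<Longrightarrow> Z \<in> I \<Longrightarrow> Y \<union> Z \<in> I"
    and A: "A \<notin> I"
    and pos: "\<And>d. d \<in> D \<Longrightarrow> E d \<notin> I"
    and dense: "\<And>Z. Z \<subseteq> A \<Longrightarrow> Z \<notin> I \<Longrightarrow> \<exists>d\<in>D. E d - Z \<in> I"
    and atomless: "\<And>Z. Z \<subseteq> A \<Longrightarrow> Z \<notin> I \<Longrightarrow> \<exists>C\<subseteq>Z. C \<notin> I \<and> Z - C \<notin> I"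
  shows "\<exists>F \<subseteq> I. \<Union>F \<notin> I \<and> |F| \<le>o |D|"
proof (rule ccontr)
  assume contra: "\<not> ?thesis"
  then have "\<Union>{} \<in> I" using card_of_empty by blast
  then have empty_in: "{} \<in> I" by simp
  have UN: "(\<Union>d\<in>D'. f d) \<in> I" if "D' \<subseteq> D" "\<And>d. d \<in> D' \<Longrightarrow> f d \<in> I" for D' and f :: "'d \<Rightarrow> 'a set"
  proof -
    have "|f ` D'| \<le>o |D|"
      using ordLeq_transitive[OF card_of_image card_of_mono1[OF that(1)]] .
    moreover have "f ` D' \<subseteq> I" using that(2) by blast
    ultimately show ?thesis using contra by blast
  qed
  define fib where "fib = (\<lambda>p. {x \<in> A. {d \<in> D. x \<in> E d} = p})"
  \<comment> \<open>If \<open>C\<close> split the fibre, some \<open>E d\<close> would lie almost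
    inside \<open>C\<close> and meet the fibre, hence contain all of it, so the rest of the fibre
    would be null.\<close>
  have fib: "fib p \<in> I" for p
  proof (rule ccontr)
    assume "fib p \<notin> I"
    moreover have fA: "fib p \<subseteq> A" unfolding fib_def by blast
    ultimately obtain C where C: "C \<subseteq> fib p" "C \<notin> I" "fib p - C \<notin> I"
      using atomless by blast
    then obtain d where d: "d \<in> D" "E d - C \<in> I" using dense[of C] fA by blast
    have "E d \<inter> C \<noteq> {}"
      using pos[OF d(1)] d(2) by (metis Diff_triv)
    then have "fib p \<subseteq> E d" using C(1) d(1) unfolding fib_def by blast
    then have "fib p - C \<in> I" by (intro down[OF d(2)]) blast
    then show False using C(3) by blast
  qed
  \<comment> \<open>The fibres show that \<open>\<F>\<close> is nonempty; the least size of a member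
    becomes the completeness of the image ideal.\<close>
  define \<F> where "\<F> = {F. F \<subseteq> I \<and> \<Union>F \<subseteq> A \<and> \<Union>F \<notin> I}"
  have "x \<in> fib {d \<in> D. x \<in> E d}" if "x \<in> A" for x
    using that unfolding fib_def by blast
  then have "\<Union>(fib ` Pow D) = A" unfolding fib_def by blast
  then have fib_\<F>: "fib ` Pow D \<in> \<F>" using fib A unfolding \<F>_def by auto
  then have "card_of ` \<F> \<noteq> {}" by blast
  moreover have "\<forall>r\<in>card_of ` \<F>. Card_order r"
    by (simp add: card_of_card_order_on Field_card_of)
  ultimately have "\<exists>r\<in>card_of ` \<F>. \<forall>r'\<in>card_of ` \<F>. r \<le>o r'"
    by (rule exists_minim_Card_order)
  then obtain F where F: "F \<in> \<F>" and F_min: "\<And>F'. F' \<in> \<F> \<Longrightarrow> |F| \<le>o |F'|"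
    by (elim bexE imageE) simp
  have F_props: "F \<subseteq> I" "\<Union>F \<subseteq> A" "\<Union>F \<notin> I"
    using F unfolding \<F>_def by simp_all
  then have "\<not> |F| \<le>o |D|" using contra by blast
  then have D_less: "|D| <o |F|"
    by (rule not_ordLeq_iff_ordLess[OF card_of_Well_order card_of_Well_order, THEN iffD1])
  \<comment> \<open>Members of \<open>F\<close> may overlap, so \<open>g\<close> picks one for each
    point; \<open>J\<close> below is the image ideal under \<open>g\<close>.\<close>
  define g where "g = (\<lambda>x. SOME f. f \<in> F \<and> x \<in> f)"
  have g: "g x \<in> F \<and> x \<in> g x" if "x \<in> \<Union>F" for x
    using that unfolding g_def by (rule_tac someI_ex) blast
  define pre where "pre = (\<lambda>Z. {x \<in> \<Union>F. g x \<in> Z})"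
  define J where "J = {Z. Z \<subseteq> F \<and> pre Z \<in> I}"
  have pre_A: "pre Z \<subseteq> A" for Z using F unfolding pre_def \<F>_def by blast
  have pre_F: "pre F = \<Union>F" unfolding pre_def using g by blast
  \<comment> \<open>\<open>S d\<close> is the shadow of \<open>E d\<close> on \<open>F\<close>: the least set, modulo \<open>J\<close>, whose preimage almost
    contains \<open>E d\<close>. It exists because it suffices to remove one witness for each \<open>e \<in> D\<close>.\<close>
  define killed where "killed = (\<lambda>d. {e \<in> D. \<exists>Z\<subseteq>F. E e - pre Z \<in> I \<and> E d \<inter> pre Z \<in> I})"
  define z where "z = (\<lambda>d e. SOME Z. Z \<subseteq> F \<and> E e - pre Z \<in> I \<and> E d \<inter> pre Z \<in> I)"
  have z: "z d e \<subseteq> F \<and> E e - pre (z d e) \<in> I \<and> E d \<inter> pre (z d e) \<in> I" if "e \<in> killed d" for d e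
    using that unfolding z_def killed_def by (rule_tac someI_ex) blast
  define S where "S = (\<lambda>d. F - (\<Union>e\<in>killed d. z d e))"
  have S_null: "E d \<inter> pre (F - S d) \<in> I" for d
  proof (rule down)
    show "(\<Union>e\<in>killed d. E d \<inter> pre (z d e)) \<in> I"
      using z by (intro UN) (auto simp: killed_def)
    show "E d \<inter> pre (F - S d) \<subseteq> (\<Union>e\<in>killed d. E d \<inter> pre (z d e))"
      unfolding S_def pre_def by blast
  qed
  \<comment> \<open>Were the intersection null, some \<open>E e\<close> almost inside
    \<open>pre Z\<close> would make \<open>e\<close> killed. Then \<open>E e\<close> is also almost
    inside \<open>pre (z d e)\<close>, which is disjoint from \<open>pre Z\<close>, so
    \<open>E e\<close> would be null.\<close>
  have S_pos: "E d \<inter> pre Z \<notin> I" if "d \<in> D" "Z \<subseteq> S d" "Z \<notin> J" for d Z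
  proof
    assume null: "E d \<inter> pre Z \<in> I"
    have Z: "Z \<subseteq> F" using that(2) unfolding S_def by blast
    then have "pre Z \<notin> I" using that(3) unfolding J_def by blast
    then obtain e where e: "e \<in> D" "E e - pre Z \<in> I" using dense pre_A by blast
    then have "e \<in> killed d" using null Z unfolding killed_def by blast
    then have ze: "E e - pre (z d e) \<in> I" and "pre Z \<inter> pre (z d e) = {}"
      using z that(2) unfolding S_def pre_def by blast+
    then have "E e \<subseteq> (E e - pre Z) \<union> (E e - pre (z d e))" by blast
    then have "E e \<in> I" by (rule down[OF union[OF e(2) ze]])
    then show False using pos e(1) by blast
  qed
  define P where "P = {S d | d. d \<in> D \<and> S d \<notin> J}"
  interpret ideal_with_small_density F J P
  proof
    show "Z \<in> J" if "Y \<in> J" "Z \<subseteq> Y" for Y Z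
      using that down[of "pre Y" "pre Z"] unfolding J_def pre_def by blast
    show "Y \<union> Z \<in> J" if "Y \<in> J" "Z \<in> J" for Y Z
    proof -
      have "pre (Y \<union> Z) = pre Y \<union> pre Z" unfolding pre_def by blast
      then show ?thesis using that union unfolding J_def by auto
    qed
    \<comment> \<open>A failure would give the family \<open>pre\<close> followed by
      \<open>G\<close>, an element of \<open>\<F>\<close> smaller than \<open>F\<close>.\<close>
    show "\<Union>G \<in> J" if G: "G \<subseteq> J" "|G| <o |F|" for G
    proof -
      have eq: "pre (\<Union>G) = \<Union>(pre ` G)" unfolding pre_def by blast
      have "pre ` G \<subseteq> I" using G(1) unfolding J_def by blast
      moreover have "\<not> |F| \<le>o |pre ` G|"
        using ordLeq_ordLess_trans[OF card_of_image G(2)] not_ordLess_ordLeq by blast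
      ultimately have "\<Union>(pre ` G) \<in> I"
        using F_min[of "pre ` G"] pre_A unfolding \<F>_def by blast
      then show ?thesis using G(1) unfolding J_def eq[symmetric] by blast
    qed
    show "{f} \<in> J" if "f \<in> F" for f
    proof -
      have "pre {f} \<subseteq> f" unfolding pre_def using g by blast
      then show ?thesis using that F down[of f] unfolding J_def \<F>_def by blast
    qed
    show "F \<notin> J" using F pre_F unfolding J_def \<F>_def by auto
    show "|P| <o |F|"
    proof -
      have "P \<subseteq> S ` D" unfolding P_def by blast
      then have "|P| \<le>o |D|" using ordLeq_transitive[OF card_of_mono1 card_of_image] by blast
      then show ?thesis using D_less ordLeq_ordLess_trans by blast
    qed
    show "Y \<subseteq> F" if "Y \<in> P" for Y using that unfolding P_def S_def by blast
    show "Y \<notin> J" if "Y \<in> P" for Y using that unfolding P_def by blast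
    show "\<exists>Y\<in>P. Y - Z \<in> J" if Z: "Z \<subseteq> F" "Z \<notin> J" for Z
    proof -
      have "pre Z \<notin> I" using Z unfolding J_def by blast
      then obtain d where d: "d \<in> D" "E d - pre Z \<in> I" using dense pre_A by blast
      have "S d \<notin> J"
      proof
        assume "S d \<in> J"
        then have "pre (S d) \<in> I" unfolding J_def by blast
        from union[OF union[OF this S_null] d(2)] have "E d \<in> I"
          by (rule down) (use Z(1) in \<open>auto simp: pre_def\<close>)
        then show False using pos d(1) by blast
      qed
      moreover have "S d - Z \<in> J"
      proof (rule ccontr)
        assume "S d - Z \<notin> J"
        moreover have "E d \<inter> pre (S d - Z) \<in> I"
          by (rule down[OF d(2)]) (auto simp: pre_def)
        ultimately show False using S_pos[OF d(1), of "S d - Z"] by blast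
      qed
      ultimately show ?thesis using d(1) unfolding P_def by blast
    qed
  qed
  have "|F| \<le>o |Pow D|"
    using ordLeq_transitive[OF F_min[OF fib_\<F>] card_of_image] .
  then show False using not_le_Pow[OF D_less] by blast
qed

section \<open>Classes modulo an ideal and their representatives\<close>

locale set_ideal =
  fixes J :: "'a set set"
  assumes down: "Y \<in> J \<Longrightarrow> Z \<subseteq> Y \<Longrightarrow> Z \<in> J"
    and union: "Y \<in> J \<Longrightarrow> Z \<in> J \<Longrightarrow> Y \<union> Z \<in> J"
    and empty_in: "{} \<in> J"
begin

lemma equiv_qrel: "equiv (Pow X) (qrel X J)"
proof (rule equivI)
  show "trans (qrel X J)"
  proof (rule transI)
    fix U V W assume "(U, V) \<in> qrel X J" "(V, W) \<in> qrel X J"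
    then have uv: "U \<subseteq> X" "W \<subseteq> X" "U - V \<in> J" "V - U \<in> J" "V - W \<in> J" "W - V \<in> J"
      unfolding qrel_def by auto
    have "U - W \<in> J" by (rule down[OF union[OF uv(3,5)]]) blast
    moreover have "W - U \<in> J" by (rule down[OF union[OF uv(4,6)]]) blast
    ultimately show "(U, W) \<in> qrel X J" using uv unfolding qrel_def by blast
  qed
qed (auto simp: refl_on_def sym_def qrel_def empty_in)

lemma class_pos:
  assumes "Y \<subseteq> X" "Y \<notin> J"
  shows "qrel X J `` {Y} \<in> quot_pos X J"
proof -
  have "(Y, {}) \<notin> qrel X J" using assms unfolding qrel_def by auto
  moreover have "(Y, Y) \<in> qrel X J" using assms(1) empty_in unfolding qrel_def by auto
  ultimately have "qrel X J `` {Y} \<noteq> qzero X J"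
    unfolding qzero_def using equiv_qrel[of X] by (metis Image_singleton_iff equiv_def symE)
  then show ?thesis using assms(1) unfolding quot_pos_def quot_def by (auto intro: quotientI)
qed

lemma pos_class_mem:
  assumes "b \<in> quot_pos X J" "B \<in> b"
  shows "B \<subseteq> X" "B \<notin> J" "b = qrel X J `` {B}"
proof -
  note eq = equiv_qrel[of X]
  show B: "b = qrel X J `` {B}"
    using assms eq unfolding quot_pos_def quot_def
    by (metis DiffD1 Image_singleton_iff equiv_class_eq quotientE)
  show "B \<subseteq> X" using assms(2) unfolding B qrel_def by blast
  show "B \<notin> J"
  proof
    assume "B \<in> J"
    then have "({}, B) \<in> qrel X J" using \<open>B \<subseteq> X\<close> empty_in unfolding qrel_def by auto
    then have "b = qzero X J" unfolding B qzero_def using equiv_class_eq[OF eq] by metis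
    then show False using assms(1) unfolding quot_pos_def by blast
  qed
qed

lemma pos_nonempty:
  assumes "b \<in> quot_pos X J"
  shows "\<exists>B. B \<in> b"
  using assms in_quotient_imp_non_empty[OF equiv_qrel]
  unfolding quot_pos_def quot_def by blast

text \<open>\<open>qle\<close> asks for some pair of representatives; any other pair changes the
  difference only by null sets.\<close>

lemma qle_class:
  assumes "b \<in> quot_pos X J" "c \<in> quot_pos X J" "B \<in> b" "C \<in> c"
  shows "qle J b c \<longleftrightarrow> B - C \<in> J"
proof
  assume "qle J b c"
  then obtain B' C' where BC: "B' \<in> b" "C' \<in> c" "B' - C' \<in> J" unfolding qle_def by blast
  have BB': "B - B' \<in> J" using pos_class_mem(3)[OF assms(1,3)] BC(1) unfolding qrel_def by blast
  have C'C: "C' - C \<in> J" using pos_class_mem(3)[OF assms(2,4)] BC(2) unfolding qrel_def by blast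
  show "B - C \<in> J"
    by (rule down[OF union[OF union[OF BB' BC(3)] C'C]]) blast
qed (use assms(3,4) in \<open>auto simp: qle_def\<close>)

end

section \<open>Application to the quotient algebra\<close>

theorem theorem1:
  fixes X :: "'a set" and I :: "'a set set" and A :: "'a set" and D :: "'a set set set"
  assumes "ideal_on X I"
    and "quot_atomless X I"
    and "A \<subseteq> X" and "A \<notin> I"
    and "quot_dense X (restr X I A) D"
  shows "\<exists>F \<subseteq> I. \<Union>F \<notin> I \<and> (card_of F, card_of D) \<in> ordLeq"
\<comment> \<open>For empty \<open>X\<close> the axioms admit \<open>I = {}\<close>, which lacks
  even the empty set and so is no \<open>set_ideal\<close>; there the empty family is a
  witness.\<close>
proof (cases "I = {}")
  case True
  then show ?thesis by (intro exI[of _ "{}"]) (auto simp: card_of_empty)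
next
  case False
  have un: "Z \<in> I" if "Y \<in> I" "Y' \<in> I" "Z \<subseteq> Y \<union> Y'" for Y Y' Z
    using assms(1) that unfolding ideal_on_def by blast
  interpret I: set_ideal I
    using un False by unfold_locales blast+
  have restr: "restr X I A = {B. B \<subseteq> X \<and> B \<inter> A \<in> I}" unfolding restr_def ..
  interpret R: set_ideal "restr X I A"
    using I.down I.union I.empty_in by unfold_locales (auto simp: restr Int_Un_distrib2 intro: I.down)
  \<comment> \<open>Cutting representatives down to \<open>A\<close> turns positivity and order
    modulo \<open>restr X I A\<close> into positivity and inclusion modulo \<open>I\<close>.\<close>
  define E where "E = (\<lambda>d. (SOME B. B \<in> d) \<inter> A)"
  have Dpos: "d \<in> quot_pos X (restr X I A)" if "d \<in> D" for d
    using assms(5) that unfolding quot_dense_def by blast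
  have mem: "(SOME B. B \<in> d) \<in> d" if "d \<in> D" for d
    using R.pos_nonempty[OF Dpos[OF that]] by (rule someI_ex)
  show ?thesis
  proof (rule incomplete_of_dense_family[where A = A and E = E])
    show "E d \<notin> I" if "d \<in> D" for d
      using R.pos_class_mem(1,2)[OF Dpos mem, OF that that] unfolding E_def restr by blast
    show "\<exists>d\<in>D. E d - Z \<in> I" if "Z \<subseteq> A" "Z \<notin> I" for Z
    proof -
      let ?c = "qrel X (restr X I A) `` {Z}"
      have c: "?c \<in> quot_pos X (restr X I A)"
        using that assms(3) by (intro R.class_pos) (auto simp: restr Int_absorb2)
      then obtain d where d: "d \<in> D" "qle (restr X I A) d ?c"
        using assms(5) unfolding quot_dense_def by blast
      have "Z \<in> ?c" using that assms(3) R.empty_in unfolding qrel_def by auto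
      then have "(SOME B. B \<in> d) - Z \<in> restr X I A"
        using R.qle_class[OF Dpos[OF d(1)] c mem[OF d(1)]] d(2) by blast
      then have "((SOME B. B \<in> d) - Z) \<inter> A \<in> I" unfolding restr by blast
      then have "E d - Z \<in> I" by (rule I.down) (auto simp: E_def)
      then show ?thesis using d(1) by blast
    qed
    \<comment> \<open>The piece is \<open>C \<inter> Z\<close> for a representative \<open>C\<close>
      of a positive class strictly below that of \<open>Z\<close>.\<close>
    show "\<exists>C\<subseteq>Z. C \<notin> I \<and> Z - C \<notin> I" if Z: "Z \<subseteq> A" "Z \<notin> I" for Z
    proof -
      let ?b = "qrel X I `` {Z}"
      have "Z \<subseteq> X" using Z(1) assms(3) by blast
      then have b: "?b \<in> quot_pos X I" "Z \<in> ?b"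
        using I.class_pos[OF _ Z(2)] equiv_class_self[OF I.equiv_qrel] by auto
      then obtain c where c: "c \<in> quot_pos X I" "qle I c ?b" "\<not> qle I ?b c"
        using assms(2) unfolding quot_atomless_def by blast
      obtain C where C: "C \<in> c" using I.pos_nonempty[OF c(1)] by blast
      have CZ: "C - Z \<in> I" "Z - C \<notin> I"
        using I.qle_class[OF c(1) b(1) C b(2)] I.qle_class[OF b(1) c(1) b(2) C] c by blast+
      have "C \<inter> Z \<notin> I"
        using I.pos_class_mem(2)[OF c(1) C] un[OF CZ(1), of "C \<inter> Z" C] by blast
      moreover have "Z - C \<inter> Z = Z - C" by blast
      ultimately show ?thesis using CZ(2) by (metis Int_lower2)
    qed
  qed (use I.down I.union assms(4) in auto)
qed

end
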